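(* For any integer $n\ge 3$, the $n\times n$ grid is triply transitive.
   Context: The $n\times n$ grid is the graph on $\{1,\dots,n\}^2$ in which distinct $(i,j),(i',j')$ are adjacent iff $i=i'$ or $j=j'$ (the Hamming graph $H(2,n)=K_n\square K_n$). For a strongly regular graph $\Gamma=(V,E)$: $A_0=I$, $A_1$ its adjacency matrix, $A_2=J-I-A_1$; for a vertex $\omega$, $E^*_{i,\omega}$ ($i=0,1,2$) is the diagonal matrix whose diagonal is the $\omega$-row of $A_i$; $T_\omega$ is the algebra generated by $A_0,A_1,A_2,E^*_{0,\omega},E^*_{1,\omega},E^*_{2,\omega}$; $T_{0,\omega}$ is the span of all $E^*_{i,\omega}A_jE^*_{k,\omega}$; $\tilde T_\omega$ is the algebra of complex matrices commuting with the permutation matrices of the stabilizer $G_\omega$ in $G=\mathrm{Aut}(\Gamma)$. $\Gamma$ is triply transitive if $G$ is transitive and $T_{0,\omega}=T_\omega=\tilde T_\omega$ for some (equivalently every) vertex $\omega$. *)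

theory Defs
  imports Complex_Main "HOL-Library.Function_Algebras" "HOL-Combinatorics.Permutations"
begin

definition simple_graph :: "'a set \<Rightarrow> ('a \<Rightarrow> 'a \<Rightarrow> bool) \<Rightarrow> bool" where
  "simple_graph V adj \<longleftrightarrow>
     finite V \<and> (\<forall>x y. adj x y \<longrightarrow> x \<in> V \<and> y \<in> V) \<and> symp adj \<and> irreflp adj"

text \<open>The condition on \<open>k\<close> excludes edgeless and complete graphs.\<close>

definition strongly_regular :: "'a set \<Rightarrow> ('a \<Rightarrow> 'a \<Rightarrow> bool) \<Rightarrow> bool" where
  "strongly_regular V adj \<longleftrightarrow> simple_graph V adj \<and>
     (\<exists>k l m. 0 < k \<and> k + 1 < card V \<and>
        (\<forall>x\<in>V. card {z \<in> V. adj x z} = k) \<and>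
        (\<forall>x\<in>V. \<forall>y\<in>V. adj x y \<longrightarrow> card {z \<in> V. adj x z \<and> adj y z} = l) \<and>
        (\<forall>x\<in>V. \<forall>y\<in>V. x \<noteq> y \<and> \<not> adj x y \<longrightarrow> card {z \<in> V. adj x z \<and> adj y z} = m))"

definition Aut :: "'a set \<Rightarrow> ('a \<Rightarrow> 'a \<Rightarrow> bool) \<Rightarrow> ('a \<Rightarrow> 'a) set" where
  "Aut V adj = {g. g permutes V \<and> (\<forall>x\<in>V. \<forall>y\<in>V. adj (g x) (g y) \<longleftrightarrow> adj x y)}"

definition stabilizer :: "'a set \<Rightarrow> ('a \<Rightarrow> 'a \<Rightarrow> bool) \<Rightarrow> 'a \<Rightarrow> ('a \<Rightarrow> 'a) set" where
  "stabilizer V adj w = {g \<in> Aut V adj. g w = w}"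

definition vertex_transitive :: "'a set \<Rightarrow> ('a \<Rightarrow> 'a \<Rightarrow> bool) \<Rightarrow> bool" where
  "vertex_transitive V adj \<longleftrightarrow> (\<forall>x\<in>V. \<forall>y\<in>V. \<exists>g\<in>Aut V adj. g x = y)"

text \<open>A matrix with rows and columns indexed by \<open>V\<close> is a function that vanishes
  outside \<open>V \<times> V\<close>; addition, subtraction and zero are pointwise.\<close>

type_synonym 'a cmat = "'a \<Rightarrow> 'a \<Rightarrow> complex"

definition mats :: "'a set \<Rightarrow> 'a cmat set" where
  "mats V = {M. \<forall>x y. x \<notin> V \<or> y \<notin> V \<longrightarrow> M x y = 0}"

definition mscale :: "complex \<Rightarrow> 'a cmat \<Rightarrow> 'a cmat" where
  "mscale c M = (\<lambda>x y. c * M x y)"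

definition mmult :: "'a set \<Rightarrow> 'a cmat \<Rightarrow> 'a cmat \<Rightarrow> 'a cmat" where
  "mmult V A B = (\<lambda>x y. \<Sum>z\<in>V. A x z * B z y)"

global_interpretation cmat: vector_space mscale
  by unfold_locales (simp_all add: mscale_def fun_eq_iff algebra_simps)

text \<open>For generators in \<^term>\<open>mats V\<close> the hull stays inside \<^term>\<open>mats V\<close>. It is not
  unital by definition; below the identity matrix is one of the generators.\<close>

definition generated_algebra :: "'a set \<Rightarrow> 'a cmat set \<Rightarrow> 'a cmat set" where
  "generated_algebra V X =
     (\<lambda>S. cmat.subspace S \<and> (\<forall>A\<in>S. \<forall>B\<in>S. mmult V A B \<in> S)) hull X"

definition id_mat :: "'a set \<Rightarrow> 'a cmat" where
  "id_mat V = (\<lambda>x y. if x \<in> V \<and> x = y then 1 else 0)"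

definition all_ones_mat :: "'a set \<Rightarrow> 'a cmat" where
  "all_ones_mat V = (\<lambda>x y. if x \<in> V \<and> y \<in> V then 1 else 0)"

definition adj_mat :: "'a set \<Rightarrow> ('a \<Rightarrow> 'a \<Rightarrow> bool) \<Rightarrow> 'a cmat" where
  "adj_mat V adj = (\<lambda>x y. if x \<in> V \<and> y \<in> V \<and> adj x y then 1 else 0)"

definition perm_mat :: "'a set \<Rightarrow> ('a \<Rightarrow> 'a) \<Rightarrow> 'a cmat" where
  "perm_mat V g = (\<lambda>x y. if x \<in> V \<and> y \<in> V \<and> x = g y then 1 else 0)"

text \<open>Only the indices \<open>i = 0, 1, 2\<close> are used.\<close>

definition scheme_mat :: "'a set \<Rightarrow> ('a \<Rightarrow> 'a \<Rightarrow> bool) \<Rightarrow> nat \<Rightarrow> 'a cmat" where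
  "scheme_mat V adj i =
     (if i = 0 then id_mat V
      else if i = 1 then adj_mat V adj
      else all_ones_mat V - id_mat V - adj_mat V adj)"

definition dual_idem :: "'a set \<Rightarrow> ('a \<Rightarrow> 'a \<Rightarrow> bool) \<Rightarrow> 'a \<Rightarrow> nat \<Rightarrow> 'a cmat" where
  "dual_idem V adj w i = (\<lambda>x y. if x = y then scheme_mat V adj i w x else 0)"

definition terwilliger_algebra :: "'a set \<Rightarrow> ('a \<Rightarrow> 'a \<Rightarrow> bool) \<Rightarrow> 'a \<Rightarrow> 'a cmat set" where
  "terwilliger_algebra V adj w =
     generated_algebra V (scheme_mat V adj ` {0, 1, 2} \<union> dual_idem V adj w ` {0, 1, 2})"

definition triple_span :: "'a set \<Rightarrow> ('a \<Rightarrow> 'a \<Rightarrow> bool) \<Rightarrow> 'a \<Rightarrow> 'a cmat set" where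
  "triple_span V adj w =
     cmat.span {mmult V (mmult V (dual_idem V adj w i) (scheme_mat V adj j)) (dual_idem V adj w k)
                | i j k. i \<in> {0, 1, 2} \<and> j \<in> {0, 1, 2} \<and> k \<in> {0, 1, 2}}"

definition centralizer_algebra :: "'a set \<Rightarrow> ('a \<Rightarrow> 'a \<Rightarrow> bool) \<Rightarrow> 'a \<Rightarrow> 'a cmat set" where
  "centralizer_algebra V adj w =
     {M \<in> mats V. \<forall>g\<in>stabilizer V adj w. mmult V M (perm_mat V g) = mmult V (perm_mat V g) M}"

definition triply_transitive :: "'a set \<Rightarrow> ('a \<Rightarrow> 'a \<Rightarrow> bool) \<Rightarrow> bool" where
  "triply_transitive V adj \<longleftrightarrow>
     strongly_regular V adj \<and> vertex_transitive V adj \<and>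
     (\<exists>w\<in>V. triple_span V adj w = terwilliger_algebra V adj w \<and>
            terwilliger_algebra V adj w = centralizer_algebra V adj w)"

definition grid_verts :: "nat \<Rightarrow> (nat \<times> nat) set" where
  "grid_verts n = {1..n} \<times> {1..n}"

definition grid_adj :: "nat \<Rightarrow> nat \<times> nat \<Rightarrow> nat \<times> nat \<Rightarrow> bool" where
  "grid_adj n p q \<longleftrightarrow> p \<in> grid_verts n \<and> q \<in> grid_verts n \<and> p \<noteq> q \<and>
     (fst p = fst q \<or> snd p = snd q)"

end

(* The stabilizer of w has the sets of pairs (x, y) with prescribed relations among w, x, y
   as its orbits on V \<times> V as soon as every isomorphism between triples of vertices extends
   to an automorphism. The matrices E*_i A_j E*_k are the indicators of these sets, so
   they span the centralizer algebra, and the trivial inclusions T_0 \<subseteq> T \<subseteq> T~ become equalities.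
   In the grid, a map between triples that respects equality and adjacency respects, possibly after
   exchanging the two coordinates, equality of rows and equality of columns; hence it is induced
   by a permutation of the rows and a permutation of the columns. *)

theory Submission
  imports Defs
begin

section \<open>Graphs in which isomorphisms between triples extend\<close>

text \<open>For vertices this is the index \<open>i\<close> with a 1 at entry \<open>(x, y)\<close>
  of A_i. An isomorphism between triples is then a map that preserves \<open>vertex_rel\<close> on
  the three pairs.\<close>

definition vertex_rel :: "('a \<Rightarrow> 'a \<Rightarrow> bool) \<Rightarrow> 'a \<Rightarrow> 'a \<Rightarrow> nat" where
  "vertex_rel adj x y = (if x = y then 0 else if adj x y then 1 else 2)"

lemma vertex_rel_in: "vertex_rel adj x y \<in> {0, 1, 2}"
  by (simp add: vertex_rel_def)

text \<open>Irreflexivity matters on the diagonal: \<open>vertex_rel\<close> tests equality first,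
  so A_1 and A_2 must vanish there.\<close>

lemma scheme_mat_eq:
  assumes "irreflp adj" "i \<in> {0, 1, 2}"
  shows "scheme_mat V adj i x y = of_bool (x \<in> V \<and> y \<in> V \<and> vertex_rel adj x y = i)"
  using assms
  by (auto simp: scheme_mat_def id_mat_def adj_mat_def all_ones_mat_def vertex_rel_def irreflp_def)

lemma dual_idem_eq:
  assumes "irreflp adj" "i \<in> {0, 1, 2}" "w \<in> V"
  shows "dual_idem V adj w i x y = of_bool (x = y \<and> x \<in> V \<and> vertex_rel adj w x = i)"
  using assms by (simp add: dual_idem_def scheme_mat_eq)

text \<open>The outer factors are diagonal with entries 0 and 1: the left one selects rows, the
  right one columns. Thus distinct \<open>(i, j, k)\<close> give indicators of disjoint sets of
  pairs.\<close>

lemma triple_product_eq: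
  assumes "finite V" "irreflp adj" "w \<in> V" "i \<in> {0, 1, 2}" "j \<in> {0, 1, 2}" "k \<in> {0, 1, 2}"
  shows "mmult V (mmult V (dual_idem V adj w i) (scheme_mat V adj j)) (dual_idem V adj w k) x y =
    of_bool (x \<in> V \<and> y \<in> V \<and> vertex_rel adj w x = i \<and> vertex_rel adj x y = j \<and>
      vertex_rel adj w y = k)"
proof -
  have left: "mmult V (dual_idem V adj w i) (scheme_mat V adj j) x z =
      of_bool (x \<in> V \<and> z \<in> V \<and> vertex_rel adj w x = i \<and> vertex_rel adj x z = j)" for z
  proof -
    have "mmult V (dual_idem V adj w i) (scheme_mat V adj j) x z =
        (\<Sum>u\<in>V. if x = u then of_bool (x \<in> V \<and> z \<in> V \<and> vertex_rel adj w x = i \<and> vertex_rel adj x z = j) else 0)"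
      unfolding mmult_def using assms
      by (intro sum.cong) (auto simp: dual_idem_eq scheme_mat_eq)
    then show ?thesis
      using assms(1) by simp
  qed
  have "mmult V (mmult V (dual_idem V adj w i) (scheme_mat V adj j)) (dual_idem V adj w k) x y =
      (\<Sum>u\<in>V. if u = y then of_bool (x \<in> V \<and> y \<in> V \<and> vertex_rel adj w x = i \<and>
        vertex_rel adj x y = j \<and> vertex_rel adj w y = k) else 0)"
    unfolding mmult_def[of V "mmult V _ _"] left using assms
    by (intro sum.cong) (auto simp: dual_idem_eq)
  then show ?thesis
    using assms(1) by simp
qed

section \<open>Generated algebras, and T_0 inside T\<close>

lemma generated_algebra_superset: "X \<subseteq> generated_algebra V X"
  unfolding generated_algebra_def by (rule hull_subset)

lemma generated_algebra_minimal:
  assumes "X \<subseteq> S" "cmat.subspace S" "\<And>A B. A \<in> S \<Longrightarrow> B \<in> S \<Longrightarrow> mmult V A B \<in> S"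
  shows "generated_algebra V X \<subseteq> S"
  unfolding generated_algebra_def using assms by (intro hull_minimal) auto

lemma subspace_generated_algebra: "cmat.subspace (generated_algebra V X)"
  unfolding generated_algebra_def hull_def by (rule cmat.subspace_Inter) auto

lemma mmult_in_generated_algebra:
  assumes "A \<in> generated_algebra V X" "B \<in> generated_algebra V X"
  shows "mmult V A B \<in> generated_algebra V X"
  using assms unfolding generated_algebra_def hull_def by blast

lemma triple_span_subset_terwilliger: "triple_span V adj w \<subseteq> terwilliger_algebra V adj w"
  unfolding triple_span_def terwilliger_algebra_def
proof (intro cmat.span_minimal subspace_generated_algebra subsetI)
  let ?X = "scheme_mat V adj ` {0, 1, 2} \<union> dual_idem V adj w ` {0, 1, 2}"
  fix M
  assume "M \<in> {mmult V (mmult V (dual_idem V adj w i) (scheme_mat V adj j)) (dual_idem V adj w k)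
                | i j k. i \<in> {0, 1, 2} \<and> j \<in> {0, 1, 2} \<and> k \<in> {0, 1, 2}}"
  then obtain i j k
    where M: "M = mmult V (mmult V (dual_idem V adj w i) (scheme_mat V adj j)) (dual_idem V adj w k)"
      and ijk: "i \<in> {0, 1, 2}" "j \<in> {0, 1, 2}" "k \<in> {0, 1, 2}"
    by blast
  show "M \<in> generated_algebra V ?X"
    unfolding M by (intro mmult_in_generated_algebra generated_algebra_superset[THEN subsetD]
      UnI1[OF imageI[OF ijk(2)]] UnI2[OF imageI[OF ijk(1)]] UnI2[OF imageI[OF ijk(3)]])
qed

section \<open>The centralizer algebra, and T inside it\<close>

lemma commutes_perm_mat_iff:
  assumes "finite V" "M \<in> mats V" "g permutes V"
  shows "mmult V M (perm_mat V g) = mmult V (perm_mat V g) M \<longleftrightarrow>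
    (\<forall>x\<in>V. \<forall>y\<in>V. M (g x) (g y) = M x y)"
proof -
  have right: "mmult V M (perm_mat V g) x y = (if y \<in> V then M x (g y) else 0)" for x y
  proof -
    have "mmult V M (perm_mat V g) x y = (\<Sum>z\<in>V. if z = g y then (if y \<in> V then M x (g y) else 0) else 0)"
      unfolding mmult_def by (intro sum.cong) (auto simp: perm_mat_def)
    also have "\<dots> = (if y \<in> V then M x (g y) else 0)"
      using assms(1) permutes_in_image[OF assms(3)] by simp
    finally show ?thesis .
  qed
  \<comment> \<open>Reading the product in row \<open>g x\<close> leaves only the term
    \<open>z = x\<close> and avoids the inverse of \<open>g\<close>.\<close>
  have left: "mmult V (perm_mat V g) M (g x) y = (if x \<in> V then M x y else 0)" for x y
  proof -
    have "mmult V (perm_mat V g) M (g x) y = (\<Sum>z\<in>V. if z = x then M x y else 0)"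
      unfolding mmult_def using permutes_in_image[OF assms(3)] permutes_inj[OF assms(3)]
      by (intro sum.cong) (auto simp: perm_mat_def inj_def)
    then show ?thesis
      using assms(1) by simp
  qed
  \<comment> \<open>As \<open>g\<close> is surjective on the whole type, every row has the form
    \<open>g x\<close>.\<close>
  have "mmult V M (perm_mat V g) = mmult V (perm_mat V g) M \<longleftrightarrow>
      (\<forall>x y. mmult V M (perm_mat V g) (g x) y = mmult V (perm_mat V g) M (g x) y)"
    using permutes_surj[OF assms(3)] by (metis ext surjD)
  also have "\<dots> \<longleftrightarrow> (\<forall>x y. (if y \<in> V then M (g x) (g y) else 0) = (if x \<in> V then M x y else 0))"
    by (simp only: left right)
  also have "\<dots> \<longleftrightarrow> (\<forall>x\<in>V. \<forall>y\<in>V. M (g x) (g y) = M x y)"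
    using assms(2) permutes_in_image[OF assms(3)] by (auto simp: mats_def)
  finally show ?thesis .
qed

lemma stabilizerD:
  assumes "g \<in> stabilizer V adj w"
  shows "g permutes V" "g w = w"
    and "\<And>x y. x \<in> V \<Longrightarrow> y \<in> V \<Longrightarrow> vertex_rel adj (g x) (g y) = vertex_rel adj x y"
proof -
  show perm: "g permutes V" and "g w = w"
    using assms by (auto simp: stabilizer_def Aut_def)
  show "vertex_rel adj (g x) (g y) = vertex_rel adj x y" if "x \<in> V" "y \<in> V" for x y
    using assms that permutes_inj[OF perm]
    by (auto simp: stabilizer_def Aut_def vertex_rel_def inj_def)
qed

lemma mem_centralizer_algebra_iff:
  assumes "finite V"
  shows "M \<in> centralizer_algebra V adj w \<longleftrightarrow>
    M \<in> mats V \<and> (\<forall>g\<in>stabilizer V adj w. \<forall>x\<in>V. \<forall>y\<in>V. M (g x) (g y) = M x y)"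
  unfolding centralizer_algebra_def mem_Collect_eq
  by (intro conj_cong ball_cong refl commutes_perm_mat_iff[OF assms] stabilizerD(1))

text \<open>Entries of the generators depend only on equality and on \<open>vertex_rel\<close>,
  possibly relative to \<open>w\<close>, and the stabilizer preserves all of these. Invariance of
  entries survives linear combinations and products.\<close>

lemma terwilliger_subset_centralizer:
  assumes "finite V" "irreflp adj" "w \<in> V"
  shows "terwilliger_algebra V adj w \<subseteq> centralizer_algebra V adj w"
  unfolding terwilliger_algebra_def
proof (rule generated_algebra_minimal)
  note mem = mem_centralizer_algebra_iff[OF assms(1)]
  have gV: "g x \<in> V \<longleftrightarrow> x \<in> V" if "g \<in> stabilizer V adj w" for g x
    using permutes_in_image[OF stabilizerD(1)[OF that]] .
  have inj: "g x = g y \<longleftrightarrow> x = y" if "g \<in> stabilizer V adj w" for g x y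
    using permutes_inj[OF stabilizerD(1)[OF that]] by (auto simp: inj_def)
  have rel_w: "vertex_rel adj w (g x) = vertex_rel adj w x"
    if "g \<in> stabilizer V adj w" "x \<in> V" for g x
    using stabilizerD(2)[OF that(1)] stabilizerD(3)[OF that(1) assms(3) that(2)] by simp
  have "scheme_mat V adj i \<in> centralizer_algebra V adj w" if "i \<in> {0, 1, 2}" for i
    unfolding mem using that assms(2)
    by (simp add: mats_def scheme_mat_eq gV stabilizerD(3) cong: conj_cong)
  moreover have "dual_idem V adj w i \<in> centralizer_algebra V adj w" if "i \<in> {0, 1, 2}" for i
    unfolding mem using that assms(2,3)
    by (simp add: mats_def dual_idem_eq gV inj rel_w cong: conj_cong)
  ultimately show "scheme_mat V adj ` {0, 1, 2} \<union> dual_idem V adj w ` {0, 1, 2}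
      \<subseteq> centralizer_algebra V adj w"
    by blast
  show "cmat.subspace (centralizer_algebra V adj w)"
    unfolding cmat.subspace_def by (auto simp: mem mats_def mscale_def)
  fix A B
  assume A: "A \<in> centralizer_algebra V adj w" and B: "B \<in> centralizer_algebra V adj w"
  have "mmult V A B (g x) (g y) = mmult V A B x y"
    if g: "g \<in> stabilizer V adj w" and "x \<in> V" "y \<in> V" for g x y
  proof -
    \<comment> \<open>The summation index is replaced by its image under \<open>g\<close>, so that
      both factors become invariant entries.\<close>
    have "mmult V A B (g x) (g y) = (\<Sum>z\<in>V. A (g x) (g z) * B (g z) (g y))"
      unfolding mmult_def
      by (rule sum.permute[OF stabilizerD(1)[OF g], unfolded o_def])
    also have "\<dots> = mmult V A B x y"
      unfolding mmult_def using A B that by (intro sum.cong) (auto simp: mem)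
    finally show ?thesis .
  qed
  moreover have "mmult V A B \<in> mats V"
    using A B by (auto simp: mem mats_def mmult_def)
  ultimately show "mmult V A B \<in> centralizer_algebra V adj w"
    by (simp add: mem)
qed

text \<open>By \<open>homog\<close>, pairs of the same type relative to \<open>w\<close> lie in one
  orbit of the stabilizer. An invariant matrix is therefore constant on each type, which makes it a
  combination of the indicators of the types.\<close>

lemma centralizer_subset_triple_span:
  assumes "finite V" "irreflp adj" "w \<in> V"
    and homog: "\<And>x y x' y'. \<lbrakk>x \<in> V; y \<in> V; x' \<in> V; y' \<in> V;
        vertex_rel adj w x = vertex_rel adj w x'; vertex_rel adj x y = vertex_rel adj x' y';
        vertex_rel adj w y = vertex_rel adj w y'\<rbrakk>
      \<Longrightarrow> \<exists>g\<in>stabilizer V adj w. g x = x' \<and> g y = y'"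
  shows "centralizer_algebra V adj w \<subseteq> triple_span V adj w"
proof
  fix M
  assume "M \<in> centralizer_algebra V adj w"
  then have M: "M \<in> mats V"
    and inv: "\<And>g x y. \<lbrakk>g \<in> stabilizer V adj w; x \<in> V; y \<in> V\<rbrakk> \<Longrightarrow> M (g x) (g y) = M x y"
    by (auto simp: mem_centralizer_algebra_iff[OF assms(1)])
  define I where "I = {0, 1, 2 :: nat}"
  define type where
    "type x y = (vertex_rel adj w x, vertex_rel adj x y, vertex_rel adj w y)" for x y
  define P where "P = (\<lambda>(i, j, k).
    mmult V (mmult V (dual_idem V adj w i) (scheme_mat V adj j)) (dual_idem V adj w k))"
  \<comment> \<open>The common value of \<open>M\<close> on the pairs of type \<open>t\<close>. If
    no pair has type \<open>t\<close>, the value is arbitrary but harmless, because then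
    \<open>P t\<close> is zero.\<close>
  define c where "c t = (SOME v. \<exists>x\<in>V. \<exists>y\<in>V. type x y = t \<and> v = M x y)" for t
  have c: "c (type x y) = M x y" if "x \<in> V" "y \<in> V" for x y
  proof -
    have eq: "M x' y' = M x y" if xy': "x' \<in> V" "y' \<in> V" "type x' y' = type x y" for x' y'
    proof -
      obtain g where "g \<in> stabilizer V adj w" "g x = x'" "g y = y'"
        using homog[of x y x' y'] xy' \<open>x \<in> V\<close> \<open>y \<in> V\<close> unfolding type_def prod.inject by metis
      then show ?thesis
        using inv \<open>x \<in> V\<close> \<open>y \<in> V\<close> by blast
    qed
    show ?thesis
      unfolding c_def
    proof (rule some_equality)
      show "\<exists>x'\<in>V. \<exists>y'\<in>V. type x' y' = type x y \<and> M x y = M x' y'"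
        using that by blast
    qed (use eq in blast)
  qed
  have P: "P t x y = of_bool (x \<in> V \<and> y \<in> V \<and> type x y = t)" if "t \<in> I \<times> I \<times> I" for t x y
    using that triple_product_eq[OF assms(1-3)]
    unfolding I_def type_def P_def by (cases t) (simp only: prod.case mem_Times_iff fst_conv snd_conv prod.inject)
  have "M x y = (\<Sum>t\<in>I \<times> I \<times> I. mscale (c t) (P t)) x y" for x y
  proof -
    have "(\<Sum>t\<in>T. mscale (c t) (P t)) x y = (\<Sum>t\<in>T. c t * P t x y)" for T
      by (induction T rule: infinite_finite_induct) (simp_all add: mscale_def)
    then have "(\<Sum>t\<in>I \<times> I \<times> I. mscale (c t) (P t)) x y = (\<Sum>t\<in>I \<times> I \<times> I. c t * P t x y)" .
    also have "\<dots> = (\<Sum>t\<in>I \<times> I \<times> I. if t = type x y then of_bool (x \<in> V \<and> y \<in> V) * M x y else 0)"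
      by (intro sum.cong) (auto simp: P c)
    also have "\<dots> = of_bool (x \<in> V \<and> y \<in> V) * M x y"
    proof -
      have "type x y \<in> I \<times> I \<times> I"
        unfolding I_def type_def by (intro SigmaI vertex_rel_in)
      moreover have "finite (I \<times> I \<times> I)"
        by (simp add: I_def)
      ultimately show ?thesis
        by (simp only: sum.delta if_True)
    qed
    \<comment> \<open>Outside V \<times> V both sides are 0, since \<open>M\<close> lies in
      \<open>mats V\<close>.\<close>
    also have "\<dots> = M x y"
      using M by (auto simp: mats_def)
    finally show ?thesis by simp
  qed
  then have "M = (\<Sum>t\<in>I \<times> I \<times> I. mscale (c t) (P t))"
    by blast
  also have "\<dots> \<in> triple_span V adj w"
    unfolding triple_span_def
  proof (intro cmat.span_sum cmat.span_scale cmat.span_base)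
    fix t
    assume "t \<in> I \<times> I \<times> I"
    then show "P t \<in> {mmult V (mmult V (dual_idem V adj w i) (scheme_mat V adj j)) (dual_idem V adj w k)
                | i j k. i \<in> {0, 1, 2} \<and> j \<in> {0, 1, 2} \<and> k \<in> {0, 1, 2}}"
      unfolding P_def I_def by (cases t) (simp only: prod.case mem_Sigma_iff, blast)
  qed
  finally show "M \<in> triple_span V adj w" .
qed

text \<open>The vertices of a triple may coincide. Constant triples give vertex transitivity, and
  triples that start with \<open>w\<close> on both sides give automorphisms in the stabilizer of
  \<open>w\<close>.\<close>

lemma triply_transitiveI:
  assumes "strongly_regular V adj" "V \<noteq> {}"
    and homog: "\<And>x y z x' y' z'. \<lbrakk>x \<in> V; y \<in> V; z \<in> V; x' \<in> V; y' \<in> V; z' \<in> V;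
        vertex_rel adj x y = vertex_rel adj x' y'; vertex_rel adj x z = vertex_rel adj x' z';
        vertex_rel adj y z = vertex_rel adj y' z'\<rbrakk>
      \<Longrightarrow> \<exists>g\<in>Aut V adj. g x = x' \<and> g y = y' \<and> g z = z'"
  shows "triply_transitive V adj"
proof -
  have V: "finite V" "irreflp adj"
    using assms(1) by (auto simp: strongly_regular_def simple_graph_def)
  obtain w where w: "w \<in> V"
    using assms(2) by blast
  have "centralizer_algebra V adj w \<subseteq> triple_span V adj w"
  proof (rule centralizer_subset_triple_span[OF V w])
    fix x y x' y'
    assume "x \<in> V" "y \<in> V" "x' \<in> V" "y' \<in> V"
      "vertex_rel adj w x = vertex_rel adj w x'" "vertex_rel adj x y = vertex_rel adj x' y'"
      "vertex_rel adj w y = vertex_rel adj w y'"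
    then show "\<exists>g\<in>stabilizer V adj w. g x = x' \<and> g y = y'"
      using homog[of w x y w x' y'] w unfolding stabilizer_def by blast
  qed
  then have "triple_span V adj w = terwilliger_algebra V adj w"
    "terwilliger_algebra V adj w = centralizer_algebra V adj w"
    using triple_span_subset_terwilliger[of V adj w] terwilliger_subset_centralizer[OF V w]
    by auto
  moreover have "vertex_transitive V adj"
    unfolding vertex_transitive_def
  proof (intro ballI)
    fix x y
    assume "x \<in> V" "y \<in> V"
    then show "\<exists>g\<in>Aut V adj. g x = y"
      using homog[of x x x y y y] by (auto simp: vertex_rel_def)
  qed
  ultimately show ?thesis
    using assms(1) w unfolding triply_transitive_def by blast
qed

section \<open>Grids\<close>

lemma permutes_extending_inj:
  assumes "finite A" "B \<subseteq> A" "f ` B \<subseteq> A" "inj_on f B"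
  obtains p where "p permutes A" "\<And>b. b \<in> B \<Longrightarrow> p b = f b"
proof -
  have fin: "finite B" "finite (f ` B)"
    using assms(1,2) finite_subset by auto
  \<comment> \<open>Since \<open>f\<close> is injective on \<open>B\<close>, the complements of
    \<open>B\<close> and of its image in the finite set \<open>A\<close> have equal size; any
    bijection between them completes \<open>f\<close>.\<close>
  have "card (A - B) = card (A - f ` B)"
    using assms fin by (simp add: card_Diff_subset card_image)
  then obtain h where h: "bij_betw h (A - B) (A - f ` B)"
    using assms(1) finite_same_card_bij[of "A - B" "A - f ` B"] by auto
  define p where "p x = (if x \<in> B then f x else if x \<in> A then h x else x)" for x
  have "bij_betw p B (f ` B)"
    using assms(4) by (simp add: bij_betw_def p_def inj_on_def image_def)
  moreover have "bij_betw p (A - B) (A - f ` B)"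
    using h by (rule bij_betw_cong[THEN iffD1, rotated]) (simp add: p_def)
  ultimately have "bij_betw p (B \<union> (A - B)) (f ` B \<union> (A - f ` B))"
    by (rule bij_betw_combine) auto
  moreover have "B \<union> (A - B) = A" "f ` B \<union> (A - f ` B) = A"
    using assms by auto
  ultimately have "p permutes A"
    using assms(2) by (intro bij_imp_permutes) (auto simp: p_def)
  then show thesis
    using that by (simp add: p_def)
qed

lemma permutes_mapping_triple:
  assumes "finite A" "{a, b, c, a', b', c'} \<subseteq> A"
    and "a = b \<longleftrightarrow> a' = b'" "a = c \<longleftrightarrow> a' = c'" "b = c \<longleftrightarrow> b' = c'"
  obtains p where "p permutes A" "p a = a'" "p b = b'" "p c = c'"
proof -
  \<comment> \<open>If some of \<open>a\<close>, \<open>b\<close>, \<open>c\<close> coincide, so do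
    their targets, hence the order of the cases does not matter. The converse implications make
    \<open>f\<close> injective.\<close>
  define f where "f x = (if x = a then a' else if x = b then b' else c')" for x
  have "f a = a'" "f b = b'" "f c = c'"
    using assms(3-5) by (auto simp: f_def)
  moreover have "inj_on f {a, b, c}"
    using assms(3-5) by (auto simp: f_def inj_on_def)
  ultimately show thesis
    using permutes_extending_inj[of A "{a, b, c}" f] assms(1,2) that
    by (metis image_empty image_insert insertCI insert_subset)
qed

section \<open>Automorphisms of the grid\<close>

lemma restrict_in_Aut:
  assumes "bij_betw f V V" "\<And>x y. x \<in> V \<Longrightarrow> y \<in> V \<Longrightarrow> adj (f x) (f y) \<longleftrightarrow> adj x y"
  shows "(\<lambda>x. if x \<in> V then f x else x) \<in> Aut V adj"
proof -
  \<comment> \<open>Members of \<open>Aut\<close> must fix every point outside \<open>V\<close>,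
    hence the extension by the identity.\<close>
  have "bij_betw (\<lambda>x. if x \<in> V then f x else x) V V"
    using assms(1) by (rule bij_betw_cong[THEN iffD1, rotated]) simp
  then have "(\<lambda>x. if x \<in> V then f x else x) permutes V"
    by (rule bij_imp_permutes) simp
  then show ?thesis
    using assms(2) by (simp add: Aut_def)
qed

lemma Aut_comp:
  assumes "g \<in> Aut V adj" "h \<in> Aut V adj"
  shows "g \<circ> h \<in> Aut V adj"
  using assms permutes_in_image[of h V] by (simp add: Aut_def permutes_compose)

text \<open>Independent permutations \<open>p\<close> and \<open>q\<close> of the two coordinates
  preserve adjacency. Matching equalities in each coordinate are what allows \<open>p\<close> and
  \<open>q\<close> to be chosen with the prescribed values.\<close>

lemma grid_Aut_rows_columns:
  assumes V: "{x, y, z, x', y', z'} \<subseteq> grid_verts n"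
    and fst: "fst x = fst y \<longleftrightarrow> fst x' = fst y'" "fst x = fst z \<longleftrightarrow> fst x' = fst z'"
      "fst y = fst z \<longleftrightarrow> fst y' = fst z'"
    and snd: "snd x = snd y \<longleftrightarrow> snd x' = snd y'" "snd x = snd z \<longleftrightarrow> snd x' = snd z'"
      "snd y = snd z \<longleftrightarrow> snd y' = snd z'"
  shows "\<exists>g\<in>Aut (grid_verts n) (grid_adj n). g x = x' \<and> g y = y' \<and> g z = z'"
proof -
  have "{fst x, fst y, fst z, fst x', fst y', fst z'} \<subseteq> {1..n}"
    and "{snd x, snd y, snd z, snd x', snd y', snd z'} \<subseteq> {1..n}"
    using V by (auto simp: grid_verts_def)
  then obtain p q where p: "p permutes {1..n}" "p (fst x) = fst x'" "p (fst y) = fst y'" "p (fst z) = fst z'"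
    and q: "q permutes {1..n}" "q (snd x) = snd x'" "q (snd y) = snd y'" "q (snd z) = snd z'"
    using permutes_mapping_triple[OF finite_atLeastAtMost _ fst]
      permutes_mapping_triple[OF finite_atLeastAtMost _ snd] by metis
  have bij: "bij_betw (map_prod p q) (grid_verts n) (grid_verts n)"
    unfolding grid_verts_def using p(1) q(1)
    by (intro bij_betw_map_prod) (simp_all add: permutes_imp_bij)
  have inj: "p a = p b \<longleftrightarrow> a = b" "q a = q b \<longleftrightarrow> a = b" for a b
    using permutes_inj[OF p(1)] permutes_inj[OF q(1)] by (simp_all add: inj_eq)
  have "(\<lambda>u. if u \<in> grid_verts n then map_prod p q u else u) \<in> Aut (grid_verts n) (grid_adj n)"
    using bij_betwE[OF bij] by (intro restrict_in_Aut bij) (simp add: grid_adj_def inj prod_eq_iff)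
  then show ?thesis
    by (rule bexI[rotated]) (use V p(2-4) q(2-4) in \<open>simp add: prod_eq_iff\<close>)
qed

lemma grid_Aut_swap:
  "(\<lambda>u. if u \<in> grid_verts n then prod.swap u else u) \<in> Aut (grid_verts n) (grid_adj n)"
proof (rule restrict_in_Aut)
  show "bij_betw prod.swap (grid_verts n) (grid_verts n)"
    by (rule bij_betw_byWitness[where f' = prod.swap]) (auto simp: grid_verts_def)
  fix x y
  show "grid_adj n (prod.swap x) (prod.swap y) \<longleftrightarrow> grid_adj n x y"
    by (cases x; cases y) (auto simp only: grid_adj_def grid_verts_def swap_simp mem_Sigma_iff
      fst_conv snd_conv prod.inject)
qed

text \<open>Equality of a coordinate is transitive. So three distinct, pairwise adjacent vertices
  lie on one line, while two adjacent pairs sharing a vertex, with distinct nonadjacent ends, use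
  one row and one column. Hence the three relations fix the pattern of row and column equalities up
  to exchanging rows with columns.\<close>

lemma grid_homogeneous:
  assumes V: "{x, y, z, x', y', z'} \<subseteq> grid_verts n"
    and rel: "vertex_rel (grid_adj n) x y = vertex_rel (grid_adj n) x' y'"
      "vertex_rel (grid_adj n) x z = vertex_rel (grid_adj n) x' z'"
      "vertex_rel (grid_adj n) y z = vertex_rel (grid_adj n) y' z'"
  shows "\<exists>g\<in>Aut (grid_verts n) (grid_adj n). g x = x' \<and> g y = y' \<and> g z = z'"
proof -
  \<comment> \<open>For vertices of the grid, \<open>vertex_rel\<close> differs from 2 exactly when
    they share a coordinate, the case \<open>u = v\<close> included. This leaves conditions on
    equalities of coordinates only.\<close>
  have lines: "(u = v \<longleftrightarrow> u' = v') \<and> (fst u = fst v \<or> snd u = snd v \<longleftrightarrow> fst u' = fst v' \<or> snd u' = snd v')"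
    if "vertex_rel (grid_adj n) u v = vertex_rel (grid_adj n) u' v'" "{u, v, u', v'} \<subseteq> grid_verts n"
    for u v u' v'
    using that by (auto simp: vertex_rel_def grid_adj_def split: if_splits)
  have "(fst x = fst y \<longleftrightarrow> fst x' = fst y') \<and> (fst x = fst z \<longleftrightarrow> fst x' = fst z') \<and>
      (fst y = fst z \<longleftrightarrow> fst y' = fst z') \<and> (snd x = snd y \<longleftrightarrow> snd x' = snd y') \<and>
      (snd x = snd z \<longleftrightarrow> snd x' = snd z') \<and> (snd y = snd z \<longleftrightarrow> snd y' = snd z') \<or>
    (fst x = fst y \<longleftrightarrow> snd x' = snd y') \<and> (fst x = fst z \<longleftrightarrow> snd x' = snd z') \<and>
      (fst y = fst z \<longleftrightarrow> snd y' = snd z') \<and> (snd x = snd y \<longleftrightarrow> fst x' = fst y') \<and>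
      (snd x = snd z \<longleftrightarrow> fst x' = fst z') \<and> (snd y = snd z \<longleftrightarrow> fst y' = fst z')"
    (is "?same \<or> ?swapped")
    using lines[OF rel(1)] lines[OF rel(2)] lines[OF rel(3)] V
    unfolding prod_eq_iff by (smt (verit) insert_subset empty_subsetI)
  then show ?thesis
  proof
    assume ?same
    then show ?thesis
      using grid_Aut_rows_columns[OF V] by blast
  next
    assume ?swapped
    have V': "{x, y, z, prod.swap x', prod.swap y', prod.swap z'} \<subseteq> grid_verts n"
      using V by (auto simp: grid_verts_def)
    \<comment> \<open>The swapped pattern is the plain one for the targets with exchanged
      coordinates. Following \<open>g\<close> by the exchange restores the intended targets.\<close>
    obtain g where g: "g \<in> Aut (grid_verts n) (grid_adj n)"
      "g x = prod.swap x'" "g y = prod.swap y'" "g z = prod.swap z'"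
      using grid_Aut_rows_columns[OF V'] \<open>?swapped\<close> by auto
    show ?thesis
      by (rule bexI[OF _ Aut_comp[OF grid_Aut_swap g(1)]]) (use V' g in simp)
  qed
qed

section \<open>The grid as a strongly regular graph\<close>

lemma strongly_regular_grid:
  assumes "n \<ge> 2"
  shows "strongly_regular (grid_verts n) (grid_adj n)"
proof -
  let ?V = "grid_verts n" and ?adj = "grid_adj n"
  have "simple_graph ?V ?adj"
    by (auto simp: simple_graph_def grid_verts_def grid_adj_def symp_def irreflp_def)
  moreover have "2 * (n - 1) + 1 < card ?V"
  proof -
    \<comment> \<open>Writing \<open>n\<close> as \<open>m + 2\<close> removes the truncated
      subtraction. The two sides differ by the square of \<open>n - 1\<close>, which is
      positive.\<close>
    obtain m where "n = Suc (Suc m)"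
      using assms by (metis add_2_eq_Suc le_Suc_ex)
    then show ?thesis
      by (simp add: grid_verts_def)
  qed
  moreover have "card {z \<in> ?V. ?adj x z} = 2 * (n - 1)" if x: "x \<in> ?V" for x
  proof -
    \<comment> \<open>The neighbours form the two lines through \<open>x\<close> with
      \<open>x\<close> removed, which are disjoint and have \<open>n - 1\<close> points
      each.\<close>
    have "{z \<in> ?V. ?adj x z} = {fst x} \<times> ({1..n} - {snd x}) \<union> ({1..n} - {fst x}) \<times> {snd x}"
      using x by (auto simp: grid_adj_def grid_verts_def)
    moreover have "card \<dots> = card ({fst x} \<times> ({1..n} - {snd x})) + card (({1..n} - {fst x}) \<times> {snd x})"
      by (rule card_Un_disjoint) auto
    ultimately show ?thesis
      using x by (simp add: card_cartesian_product grid_verts_def mem_Times_iff)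
  qed
  moreover have "card {z \<in> ?V. ?adj x z \<and> ?adj y z} = n - 2"
    if "x \<in> ?V" "y \<in> ?V" and xy: "?adj x y" for x y
  proof -
    obtain a b c d where x: "x = (a, b)" and y: "y = (c, d)"
      by (cases x, cases y)
    have ab: "{a, c} \<subseteq> {1..n}" "{b, d} \<subseteq> {1..n}"
      using that(1,2) by (simp_all add: x y grid_verts_def)
    \<comment> \<open>Adjacent vertices share exactly one line. A common neighbour off that line
      would have to agree with both in the other coordinate, where they differ; so the common
      neighbours are the remaining \<open>n - 2\<close> points of the line.\<close>
    consider "a = c" "b \<noteq> d" | "a \<noteq> c" "b = d"
      using xy by (auto simp: x y grid_adj_def)
    then show ?thesis
    proof cases
      case 1
      then have "{z \<in> ?V. ?adj x z \<and> ?adj y z} = {a} \<times> ({1..n} - {b, d})"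
        using ab by (auto simp: x y grid_adj_def grid_verts_def)
      then show ?thesis
        using ab(2) 1 by (simp add: card_cartesian_product card_Diff_subset)
    next
      case 2
      then have "{z \<in> ?V. ?adj x z \<and> ?adj y z} = ({1..n} - {a, c}) \<times> {b}"
        using ab by (auto simp: x y grid_adj_def grid_verts_def)
      then show ?thesis
        using ab(1) 2 by (simp add: card_cartesian_product card_Diff_subset)
    qed
  qed
  moreover have "card {z \<in> ?V. ?adj x z \<and> ?adj y z} = 2"
    if "x \<in> ?V" "y \<in> ?V" "x \<noteq> y \<and> \<not> ?adj x y" for x y
  proof -
    obtain a b c d where x: "x = (a, b)" and y: "y = (c, d)"
      by (cases x, cases y)
    have "a \<noteq> c" "b \<noteq> d"
      using that by (auto simp: x y grid_adj_def)
    \<comment> \<open>These are the other two corners of the rectangle with opposite corners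
      \<open>x\<close> and \<open>y\<close>.\<close>
    have "{z \<in> ?V. ?adj x z \<and> ?adj y z} = {(a, d), (c, b)}"
    proof
      show "{z \<in> ?V. ?adj x z \<and> ?adj y z} \<subseteq> {(a, d), (c, b)}"
        using \<open>a \<noteq> c\<close> \<open>b \<noteq> d\<close> by (auto simp: x y grid_adj_def)
      show "{(a, d), (c, b)} \<subseteq> {z \<in> ?V. ?adj x z \<and> ?adj y z}"
        using \<open>a \<noteq> c\<close> \<open>b \<noteq> d\<close> that(1,2) by (simp add: x y grid_adj_def grid_verts_def)
    qed
    then show ?thesis
      using \<open>a \<noteq> c\<close> by simp
  qed
  moreover have "0 < 2 * (n - 1)"
    using assms by simp
  ultimately show ?thesis
    unfolding strongly_regular_def by blast
qed

theorem theorem6p5: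
  fixes n :: nat
  assumes "n \<ge> 3"
  shows "triply_transitive (grid_verts n) (grid_adj n)"
proof (rule triply_transitiveI)
  show "strongly_regular (grid_verts n) (grid_adj n)"
    using assms by (intro strongly_regular_grid) simp
  show "grid_verts n \<noteq> {}"
    using assms by (simp add: grid_verts_def)
  fix x y z x' y' z'
  assume "x \<in> grid_verts n" "y \<in> grid_verts n" "z \<in> grid_verts n"
    "x' \<in> grid_verts n" "y' \<in> grid_verts n" "z' \<in> grid_verts n"
  then have "{x, y, z, x', y', z'} \<subseteq> grid_verts n"
    by simp
  moreover assume "vertex_rel (grid_adj n) x y = vertex_rel (grid_adj n) x' y'"
    "vertex_rel (grid_adj n) x z = vertex_rel (grid_adj n) x' z'"
    "vertex_rel (grid_adj n) y z = vertex_rel (grid_adj n) y' z'"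
  ultimately show "\<exists>g\<in>Aut (grid_verts n) (grid_adj n). g x = x' \<and> g y = y' \<and> g z = z'"
    by (rule grid_homogeneous)
qed

end
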